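(* Let $f(x)=\sum_{n\geq 1}|I(321)_n|x^n$, $\varepsilon(x)=\sum_{m\geq 1}|I(321)_{2m}|x^{2m}$ and $\omega(x)=\sum_{m\geq 0}|I(321)_{2m+1}|x^{2m+1}$. Then $$\varepsilon+\omega=f,\qquad \varepsilon=2x\,\omega.$$
   Context: A permutation of length $n$ is a bijection of $\{1,\dots,n\}$. A permutation avoids $321$ if it has no indices $i<j<k$ with $\pi(i)>\pi(j)>\pi(k)$. An involution satisfies $\pi(\pi(i))=i$ for all $i$. $I(321)_n$ is the set of involutions of length $n$ avoiding $321$. *)

theory Defs
  imports "HOL-Combinatorics.Permutations" "HOL-Computational_Algebra.Formal_Power_Series"
begin

definition avoids_321 :: "nat \<Rightarrow> (nat \<Rightarrow> nat) \<Rightarrow> bool" where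
  "avoids_321 n p \<longleftrightarrow>
     \<not> (\<exists>i\<in>{1..n}. \<exists>j\<in>{1..n}. \<exists>k\<in>{1..n}. i < j \<and> j < k \<and> p i > p j \<and> p j > p k)"

(* p permutes {1..n} makes p the identity outside {1..n}, so each bijection of
   {1..n} is represented by exactly one function and card counts correctly. *)
definition I321 :: "nat \<Rightarrow> (nat \<Rightarrow> nat) set" where
  "I321 n = {p. p permutes {1..n} \<and> (\<forall>i\<in>{1..n}. p (p i) = i) \<and> avoids_321 n p}"

definition f_gf :: "int fps" where
  "f_gf = Abs_fps (\<lambda>n. if n \<ge> 1 then int (card (I321 n)) else 0)"

(* The empty permutation (n = 0) is excluded, since the sum starts at m = 1. *)
definition eps_gf :: "int fps" where
  "eps_gf = Abs_fps (\<lambda>n. if \<exists>m\<ge>1. n = 2 * m then int (card (I321 n)) else 0)"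

definition omega_gf :: "int fps" where
  "omega_gf = Abs_fps (\<lambda>n. if \<exists>m. n = 2 * m + 1 then int (card (I321 n)) else 0)"

end

(* An involution avoids 321 iff i < j <= p j always gives p i < p j. Let u be the last weak
   excedance of such a p on {1..n}. Either u = n is a fixed point, or n is
   a deficiency and then p u = n; deleting the arc {u, n} leaves such an involution of length
   n - 2 whose positions u, ..., n - 2 are all deficiencies. Counting by the length of the final
   run of deficiencies therefore gives a Pascal-type recurrence, with |I(321)_n| = n choose
   floor(n/2) as a special case, and (2m choose m) = 2 (2m-1 choose m-1). *)

theory Submission
  imports Defs
begin

section \<open>Avoidance in terms of weak excedances\<close>

definition deficient_beyond :: "nat \<Rightarrow> nat \<Rightarrow> (nat \<Rightarrow> nat) set" where
  "deficient_beyond n m = {p \<in> I321 n. \<forall>i. m < i \<and> i \<le> n \<longrightarrow> p i < i}"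

text \<open>Suppose \<open>i < j <= p j\<close> but \<open>p i > p j\<close>. If \<open>j\<close> is
  a fixed point, the positions \<open>i, j, p i\<close> form a 321 pattern; otherwise
  \<open>i, j, p j\<close> do. The condition can range over all naturals because points outside
  \<open>{1..n}\<close> are fixed.\<close>

lemma I321_iff:
  "p \<in> I321 n \<longleftrightarrow> p permutes {1..n} \<and> (\<forall>i. p (p i) = i) \<and>
     (\<forall>i j. i < j \<and> j \<le> p j \<longrightarrow> p i < p j)"
proof (intro iffI conjI allI impI)
  assume p: "p \<in> I321 n"
  then show perm: "p permutes {1..n}" by (simp add: I321_def)
  show inv: "p (p i) = i" for i
    using p perm by (cases "i \<in> {1..n}") (auto simp: I321_def permutes_not_in)
  fix i j assume ij: "i < j \<and> j \<le> p j"
  have inj: "p i \<noteq> p j" using ij inv by (metis less_irrefl)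
  show "p i < p j"
  proof (rule ccontr)
    assume "\<not> p i < p j"
    with inj have gt: "p i > p j" by simp
    have i: "i \<in> {1..n}" using gt ij perm
      by (metis permutes_not_in leD le_trans less_imp_le_nat)
    then have pi: "p i \<in> {1..n}" using perm permutes_in_image by metis
    with gt ij i have j: "j \<in> {1..n}" by auto
    then have pj: "p j \<in> {1..n}" using perm permutes_in_image by metis
    have av: "\<And>a b c. \<lbrakk>a \<in> {1..n}; b \<in> {1..n}; c \<in> {1..n}; a < b; b < c; p a > p b; p b > p c\<rbrakk> \<Longrightarrow> False"
      using p unfolding I321_def avoids_321_def by blast
    show False
    proof (cases "j = p j")
      case True
      then show ?thesis using av[OF i j pi] ij gt inv by simp
    next
      case False
      then show ?thesis using av[OF i j pj] ij gt inv by simp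
    qed
  qed
next
  assume p: "p permutes {1..n} \<and> (\<forall>i. p (p i) = i) \<and>
     (\<forall>i j. i < j \<and> j \<le> p j \<longrightarrow> p i < p j)"
  then have inv: "\<And>i. p (p i) = i" and mono: "\<And>i j. i < j \<Longrightarrow> j \<le> p j \<Longrightarrow> p i < p j"
    by blast+
  have False if "i < j" "j < k" "p i > p j" "p j > p k" for i j k
  proof (cases "j \<le> p j")
    case True
    then show False using mono[of i j] that by simp
  next
    case False
    \<comment> \<open>A deficiency \<open>j\<close> has a weak excedance as its image, since
      \<open>p (p j) = j > p j\<close>; the pattern is therefore read through the inverse, at
      \<open>p k < p j\<close>.\<close>
    then show False using mono[of "p k" "p j"] that inv by simp
  qed
  then show "p \<in> I321 n"
    using p unfolding I321_def avoids_321_def by blast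
qed

lemma deficient_beyond_iff:
  "p \<in> deficient_beyond n m \<longleftrightarrow> p permutes {1..n} \<and> (\<forall>i. p (p i) = i) \<and>
     (\<forall>i j. i < j \<and> j \<le> p j \<longrightarrow> p i < p j) \<and> (\<forall>i. m < i \<and> i \<le> n \<longrightarrow> p i < i)"
  by (auto simp: deficient_beyond_def I321_iff)

lemma deficient_beyond_self: "deficient_beyond n n = I321 n"
  by (auto simp: deficient_beyond_def)

lemma finite_deficient_beyond: "finite (deficient_beyond n m)"
  by (rule finite_subset[OF _ finite_permutations[of "{1..n}"]]) (auto simp: deficient_beyond_iff)

section \<open>Inserting and deleting the arc of the last weak excedance\<close>

text \<open>Order isomorphism from the positions other than \<open>N + 1\<close> onto those other than \<open>u\<close>;
  sending \<open>N + 1\<close> to \<open>u\<close> makes it a bijection of the naturals.\<close>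
definition shift :: "nat \<Rightarrow> nat \<Rightarrow> nat \<Rightarrow> nat" where
  "shift u N x = (if x = Suc N then u else if u \<le> x \<and> x \<le> N then Suc x else x)"

definition unshift :: "nat \<Rightarrow> nat \<Rightarrow> nat \<Rightarrow> nat" where
  "unshift u N y = (if y = u then Suc N else if u < y \<and> y \<le> Suc N then y - 1 else y)"

text \<open>If \<open>q\<close> permutes \<open>{1..N}\<close>, its conjugate by
  \<open>shift\<close> fixes \<open>u\<close> and \<open>N + 2\<close>; these two points are swapped
  instead.\<close>

definition add_arc :: "nat \<Rightarrow> nat \<Rightarrow> (nat \<Rightarrow> nat) \<Rightarrow> nat \<Rightarrow> nat" where
  "add_arc u N q x = (if x = u then Suc (Suc N) else if x = Suc (Suc N) then u
     else shift u N (q (unshift u N x)))"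

text \<open>Under \<open>unshift\<close> the ends \<open>u\<close> and \<open>N + 2\<close> of the
  arc land on \<open>N + 1\<close> and \<open>N + 2\<close>, which become fixed points outside
  \<open>{1..N}\<close>.\<close>

definition del_arc :: "nat \<Rightarrow> nat \<Rightarrow> (nat \<Rightarrow> nat) \<Rightarrow> nat \<Rightarrow> nat" where
  "del_arc u N p x = (if x = Suc N \<or> x = Suc (Suc N) then x else unshift u N (p (shift u N x)))"

context
  fixes u N :: nat
  assumes u: "1 \<le> u" "u \<le> Suc N"
begin

lemma unshift_shift: "unshift u N (shift u N x) = x"
  using u by (auto simp: shift_def unshift_def)

lemma shift_unshift: "shift u N (unshift u N x) = x"
  using u by (auto simp: shift_def unshift_def)

lemma shift_less_iff: "x \<noteq> Suc N \<Longrightarrow> y \<noteq> Suc N \<Longrightarrow> shift u N x < shift u N y \<longleftrightarrow> x < y"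
  using u by (auto simp: shift_def)

lemma shift_eq_iff: "shift u N x = u \<longleftrightarrow> x = Suc N" "shift u N x = Suc (Suc N) \<longleftrightarrow> x = Suc (Suc N)"
  using u by (auto simp: shift_def)

lemma unshift_eq_iff: "unshift u N x = Suc N \<longleftrightarrow> x = u"
    "unshift u N x = Suc (Suc N) \<longleftrightarrow> x = Suc (Suc N)"
  using u by (auto simp: unshift_def)

lemma unshift_less_iff: "x \<noteq> u \<Longrightarrow> y \<noteq> u \<Longrightarrow> unshift u N x < unshift u N y \<longleftrightarrow> x < y"
  using u by (auto simp: unshift_def)

lemma add_arc_in:
  assumes q: "q \<in> deficient_beyond N (u - 1)"
  shows "add_arc u N q \<in> deficient_beyond (Suc (Suc N)) u - deficient_beyond (Suc (Suc N)) (u - 1)"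
    and "del_arc u N (add_arc u N q) = q"
proof -
  let ?p = "add_arc u N q"
  have perm: "q permutes {1..N}" and inv: "\<And>i. q (q i) = i"
    and mono: "\<And>i j. i < j \<Longrightarrow> j \<le> q j \<Longrightarrow> q i < q j"
    and tl: "\<And>i. u \<le> i \<Longrightarrow> i \<le> N \<Longrightarrow> q i < i"
    using q u by (auto simp: deficient_beyond_iff)
  have out: "q x = x" if "x = 0 \<or> x > N" for x
    using perm that by (auto simp: permutes_not_in)
  have "q x \<in> {1..N}" if "1 \<le> x" "x \<le> N" for x
    using perm permutes_in_image[of q "{1..N}" x] that by auto
  then have rng: "q x \<le> N" if "x \<le> N" for x
    using that out[of 0] by (cases "x = 0") auto
  have q_eq: "q x = Suc N \<longleftrightarrow> x = Suc N" "q x = Suc (Suc N) \<longleftrightarrow> x = Suc (Suc N)" for x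
    using inv out by (metis lessI less_SucI)+
  have pinv: "?p (?p i) = i" for i
    using u by (simp add: add_arc_def shift_eq_iff unshift_eq_iff q_eq unshift_shift inv shift_unshift)
  have pout: "?p x = x" if "x \<notin> {1..Suc (Suc N)}" for x
    using that u out[of x] by (auto simp: add_arc_def shift_def unshift_def)
  have "bij ?p" using pinv by (metis bijI')
  then have pperm: "?p permutes {1..Suc (Suc N)}"
    using pout by (auto simp: permutes_def bij_iff)
  have ptl: "?p i < i" if "u < i" "i \<le> Suc (Suc N)" for i
  proof (cases "i = Suc (Suc N)")
    case False
    \<comment> \<open>For \<open>u < i <= N + 1\<close>, position \<open>i\<close> comes from
      \<open>i - 1\<close>, and \<open>shift\<close> raises the value there by at most one.\<close>
    then have "q (i - 1) < i - 1" using tl that by simp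
    then show ?thesis using that u by (auto simp: add_arc_def shift_def unshift_def)
  qed (use u in \<open>simp add: add_arc_def\<close>)
  have pmono: "?p i < ?p j" if ij: "i < j" "j \<le> ?p j" for i j
  proof -
    \<comment> \<open>By \<open>ptl\<close> no position strictly after \<open>u\<close> and up to
      \<open>N + 2\<close> is a weak excedance.\<close>
    consider "j > Suc (Suc N)" | "j = u" | "j < u"
      using ptl[of j] ij by linarith
    then show ?thesis
    proof cases
      case 1
      show ?thesis
      proof (cases "i \<in> {1..Suc (Suc N)}")
        case True
        then have "?p i \<in> {1..Suc (Suc N)}" using pperm permutes_in_image by metis
        then show ?thesis using 1 pout[of j] by auto
      qed (use 1 pout[of j] pout[of i] ij in auto)
    next
      case 2
      then show ?thesis using ij u rng[of i] by (auto simp: add_arc_def shift_def unshift_def)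
    next
      case 3
      then have pj: "?p j = shift u N (q j)" "?p i = shift u N (q i)"
        using ij u by (auto simp: add_arc_def unshift_def)
      \<comment> \<open>Among values up to \<open>N\<close>, \<open>shift\<close> changes only those
        that are at least \<open>u\<close>, hence already above \<open>j\<close>.\<close>
      have "j \<le> q j"
        using ij(2) 3 u pj rng[of j] by (auto simp: shift_def split: if_splits)
      then have "q i < q j" using mono ij by blast
      moreover have "q i \<noteq> Suc N" "q j \<noteq> Suc N" using q_eq 3 ij u by auto
      ultimately show ?thesis using pj shift_less_iff by simp
    qed
  qed
  have "?p \<in> deficient_beyond (Suc (Suc N)) u"
    using pperm pinv pmono ptl by (auto simp: deficient_beyond_iff)
  moreover have "?p \<notin> deficient_beyond (Suc (Suc N)) (u - 1)"
  proof
    assume "?p \<in> deficient_beyond (Suc (Suc N)) (u - 1)"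
    then have "?p u < u" using u by (auto simp: deficient_beyond_iff)
    then show False using u by (simp add: add_arc_def)
  qed
  ultimately show "?p \<in> deficient_beyond (Suc (Suc N)) u - deficient_beyond (Suc (Suc N)) (u - 1)" by blast
  show "del_arc u N ?p = q"
    using out by (auto simp: fun_eq_iff del_arc_def add_arc_def shift_eq_iff unshift_shift)
qed

lemma del_arc_in:
  assumes p: "p \<in> deficient_beyond (Suc (Suc N)) u - deficient_beyond (Suc (Suc N)) (u - 1)"
  shows "del_arc u N p \<in> deficient_beyond N (u - 1)"
    and "add_arc u N (del_arc u N p) = p"
proof -
  let ?q = "del_arc u N p"
  have perm: "p permutes {1..Suc (Suc N)}" and inv: "\<And>i. p (p i) = i"
    and mono: "\<And>i j. i < j \<Longrightarrow> j \<le> p j \<Longrightarrow> p i < p j"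
    and tl: "\<And>i. u < i \<Longrightarrow> i \<le> Suc (Suc N) \<Longrightarrow> p i < i"
    using p by (auto simp: deficient_beyond_iff)
  have "\<exists>i. u - 1 < i \<and> i \<le> Suc (Suc N) \<and> \<not> p i < i"
    using p by (auto simp: deficient_beyond_iff)
  then have pu_ge: "u \<le> p u" using tl u
    by (metis Suc_pred' not_less less_le_trans not_less_eq zero_less_one linorder_neqE_nat)
  \<comment> \<open>The image of a deficiency is an excedance, so it cannot lie beyond
    \<open>u\<close>.\<close>
  have tl': "p i \<le> u" if "u < i" "i \<le> Suc (Suc N)" for i
    using tl[OF that] tl[of "p i"] inv[of i] that by (metis leI le_trans less_imp_le_nat not_less)
  have pu: "p u = Suc (Suc N)"
  proof (rule ccontr)
    assume ne: "p u \<noteq> Suc (Suc N)"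
    have "p u \<in> {1..Suc (Suc N)}" using perm permutes_in_image[of p "{1..Suc (Suc N)}" u] u by auto
    \<comment> \<open>Otherwise \<open>N + 2\<close> is sent strictly below \<open>u\<close>, and
      monotonicity at the weak excedance \<open>u\<close> forces \<open>N + 2 < p u\<close>.\<close>
    moreover have "p (Suc (Suc N)) \<noteq> u" using ne inv by metis
    then have "p (Suc (Suc N)) < u" using tl'[of "Suc (Suc N)"] u by auto
    then have "Suc (Suc N) < p u" using mono[OF _ pu_ge] inv by metis
    ultimately show False by simp
  qed
  then have pn: "p (Suc (Suc N)) = u" using inv by metis
  have p_eq: "p x = u \<longleftrightarrow> x = Suc (Suc N)" "p x = Suc (Suc N) \<longleftrightarrow> x = u" for x
    using inv pu pn by metis+
  have tl'': "p i < u" if "u < i" "i \<le> Suc N" for i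
    using tl'[of i] that p_eq[of i] by auto
  have out: "p x = x" if "x = 0 \<or> x > Suc (Suc N)" for x
    using perm that by (auto simp: permutes_not_in)
  have qinv: "?q (?q i) = i" for i
    by (simp add: del_arc_def shift_eq_iff unshift_eq_iff p_eq unshift_shift inv shift_unshift)
  have qout: "?q x = x" if "x \<notin> {1..N}" for x
  proof (cases "x = Suc N \<or> x = Suc (Suc N)")
    case False
    with that have "x = 0 \<or> x > Suc (Suc N)" by auto
    with out[OF this] u show ?thesis by (auto simp: del_arc_def shift_def unshift_def)
  qed (simp add: del_arc_def)
  have "bij ?q" using qinv by (metis bijI')
  then have qperm: "?q permutes {1..N}"
    using qout by (auto simp: permutes_def bij_iff)
  \<comment> \<open>Position \<open>i >= u\<close> comes from \<open>i + 1\<close>, whose value is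
    below \<open>u\<close> by \<open>tl''\<close> and so is left alone by
    \<open>unshift\<close>.\<close>
  have qtl: "?q i < i" if "u - 1 < i" "i \<le> N" for i
    using tl''[of "Suc i"] that u by (auto simp: del_arc_def shift_def unshift_def)
  have qmono: "?q i < ?q j" if ij: "i < j" "j \<le> ?q j" for i j
  proof (cases "j > N")
    case True
    show ?thesis
    proof (cases "i \<in> {1..N}")
      case i: True
      then have "?q i \<in> {1..N}" using qperm permutes_in_image by metis
      then show ?thesis using True qout[of j] by auto
    qed (use True qout[of j] qout[of i] ij in auto)
  next
    case False
    then have qs: "?q j = unshift u N (p (shift u N j))" "?q i = unshift u N (p (shift u N i))"
      using ij by (auto simp: del_arc_def)
    have ne: "p (shift u N j) \<noteq> u" "p (shift u N i) \<noteq> u"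
      using p_eq shift_eq_iff False ij by auto
    have "shift u N i < shift u N j" using shift_less_iff[of i j] False ij by auto
    moreover have "\<not> unshift u N (p (shift u N j)) < unshift u N (shift u N j)"
      using ij(2) qs by (simp add: unshift_shift)
    then have "shift u N j \<le> p (shift u N j)"
      using unshift_less_iff[OF ne(1), of "shift u N j"] shift_eq_iff(1)[of j] False by auto
    ultimately have "p (shift u N i) < p (shift u N j)" by (rule mono)
    then show ?thesis using qs ne unshift_less_iff by simp
  qed
  show "?q \<in> deficient_beyond N (u - 1)"
    using qperm qinv qmono qtl by (auto simp: deficient_beyond_iff)
  show "add_arc u N ?q = p"
    using pu pn by (auto simp: fun_eq_iff add_arc_def del_arc_def unshift_eq_iff shift_unshift)
qed

lemma card_diff_deficient_beyond:
  "card (deficient_beyond (Suc (Suc N)) u - deficient_beyond (Suc (Suc N)) (u - 1)) = card (deficient_beyond N (u - 1))"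
  by (rule bij_betw_same_card[of "del_arc u N"], rule bij_betw_byWitness[where f' = "add_arc u N"])
     (use add_arc_in del_arc_in in blast)+

end

section \<open>Recurrences for the counts\<close>

lemma deficient_beyond_mono: "deficient_beyond n m \<subseteq> deficient_beyond n (Suc m)"
  by (auto simp: deficient_beyond_iff)

lemma card_deficient_beyond_Suc_diff:
  "card (deficient_beyond n (Suc m)) = card (deficient_beyond n m) + card (deficient_beyond n (Suc m) - deficient_beyond n m)"
  using card_Diff_subset[OF finite_deficient_beyond deficient_beyond_mono, of n m]
    card_mono[OF finite_deficient_beyond deficient_beyond_mono, of n m] by simp

text \<open>Split on whether \<open>m + 1\<close> is a deficiency. If not, it is the last weak
  excedance, and its arc to \<open>N + 2\<close> can be deleted.\<close>

lemma card_deficient_beyond_rec: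
  assumes "m \<le> N"
  shows "card (deficient_beyond (Suc (Suc N)) (Suc m)) = card (deficient_beyond (Suc (Suc N)) m) + card (deficient_beyond N m)"
  using card_deficient_beyond_Suc_diff[of "Suc (Suc N)" m] card_diff_deficient_beyond[of "Suc m" N] assms by simp

lemma card_deficient_beyond_self_rec:
  "card (deficient_beyond (Suc n) (Suc n)) = card (deficient_beyond (Suc n) n) + card (deficient_beyond n n)"
proof -
  have "deficient_beyond (Suc n) (Suc n) - deficient_beyond (Suc n) n = deficient_beyond n n"
  proof (intro equalityI subsetI)
    fix p assume p: "p \<in> deficient_beyond (Suc n) (Suc n) - deficient_beyond (Suc n) n"
    then have perm: "p permutes {1..Suc n}" by (simp add: deficient_beyond_iff)
    obtain i where "n < i" "i \<le> Suc n" "\<not> p i < i" using p by (auto simp: deficient_beyond_iff)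
    then have "Suc n \<le> p (Suc n)" by (metis le_antisym not_less Suc_leI)
    moreover have "p (Suc n) \<in> {1..Suc n}"
      using perm permutes_in_image[of p "{1..Suc n}" "Suc n"] by auto
    ultimately have "p (Suc n) = Suc n" by simp
    then have "p permutes {1..n}"
      using permutes_superset[OF perm, of "{1..n}"] by (auto simp: le_Suc_eq)
    then show "p \<in> deficient_beyond n n" using p by (auto simp: deficient_beyond_iff)
  next
    fix p assume p: "p \<in> deficient_beyond n n"
    then have "p permutes {1..n}" by (simp add: deficient_beyond_iff)
    then have "p permutes {1..Suc n}" "p (Suc n) = Suc n"
      by (auto intro: permutes_subset simp: permutes_not_in)
    then show "p \<in> deficient_beyond (Suc n) (Suc n) - deficient_beyond (Suc n) n"
      using p by (auto simp: deficient_beyond_iff)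
  qed
  then show ?thesis using card_deficient_beyond_Suc_diff[of "Suc n" n] by simp
qed

section \<open>Closed form of the counts\<close>

lemma deficient_beyond_0: "deficient_beyond (Suc n) 0 = {}"
proof (rule ccontr)
  assume "deficient_beyond (Suc n) 0 \<noteq> {}"
  then obtain p where p: "p \<in> deficient_beyond (Suc n) 0" by blast
  then have "p permutes {1..Suc n}" "p 1 < 1" by (auto simp: deficient_beyond_iff)
  then show False using permutes_in_image[of p "{1..Suc n}" 1] by auto
qed

text \<open>This is the diagonal case of the closed form. Pascal's rule suffices for even
  \<open>n\<close>; for odd \<open>n\<close> the symmetry of the row is needed as well.\<close>

lemma central_binomial_Suc:
  assumes "n \<ge> 1"
  shows "Suc n choose (Suc n div 2) = (n choose ((n - 1) div 2)) + (n choose (n div 2))"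
proof (cases "even n")
  case True
  then obtain k where "n = 2 * k" by blast
  then show ?thesis using assms by (cases k) auto
next
  case False
  then obtain k where k: "n = 2 * k + 1" by (elim oddE)
  then show ?thesis using binomial_symmetric[of k "2 * k + 1"] by simp
qed

text \<open>The threshold arises because the \<open>n - m\<close> deficiencies beyond
  \<open>m\<close> are sent injectively to excedances in \<open>{1..m}\<close>.\<close>

lemma card_deficient_beyond:
  "m \<le> n \<Longrightarrow> card (deficient_beyond n m) = (if n \<le> 2 * m then m choose ((2 * m - n) div 2) else 0)"
proof (induction n arbitrary: m rule: less_induct)
  case (less n)
  note IH = less.IH
  show ?case using less.prems
  proof (induction m)
    case 0
    have "deficient_beyond 0 0 = {id}" by (auto simp: deficient_beyond_iff)
    then show ?case by (cases n) (auto simp: deficient_beyond_0)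
  next
    case (Suc m)
    show ?case
    proof (cases "Suc m = n")
      case True
      then show ?thesis
        using Suc IH[of m m] card_deficient_beyond_self_rec[of m] central_binomial_Suc[of m]
        by (cases m) auto
    next
      case False
      then obtain N where N: "n = Suc (Suc N)" "m \<le> N"
        using Suc.prems by (metis Suc_le_mono le_SucE le_imp_less_Suc less_imp_Suc_add Suc_le_D)
      have *: "card (deficient_beyond n (Suc m)) = card (deficient_beyond n m) + card (deficient_beyond N m)"
        using card_deficient_beyond_rec N by simp
      have **: "card (deficient_beyond N m) = (if N \<le> 2 * m then m choose ((2 * m - N) div 2) else 0)"
        using IH N by simp
      show ?thesis
      proof (cases "n \<le> 2 * m")
        case True
        \<comment> \<open>With \<open>k = (2 * m - n) div 2\<close> the recurrence is Pascal's rule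
          for \<open>Suc m choose Suc k\<close>.\<close>
        then have "(2 * m - N) div 2 = Suc ((2 * m - n) div 2)"
          "(2 * Suc m - n) div 2 = Suc ((2 * m - n) div 2)" using N by presburger+
        then show ?thesis using True * ** Suc N by simp
      next
        case False
        \<comment> \<open>The first summand vanishes. Both other counts have lower index 0, so each
          is 1 or 0, under the equivalent conditions \<open>N <= 2 * m\<close> and
          \<open>n <= 2 * Suc m\<close>.\<close>
        then have "2 * m - N \<le> 1" using N by simp
        then have "(2 * m - N) div 2 = 0" "(2 * Suc m - n) div 2 = 0" using N by auto
        then show ?thesis using False * ** Suc N by simp
      qed
    qed
  qed
qed

lemma card_I321: "card (I321 n) = n choose (n div 2)"
  using card_deficient_beyond[of n n] by (simp add: deficient_beyond_self)

section \<open>Generating functions\<close>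

theorem theorem3p6:
  "eps_gf + omega_gf = f_gf \<and> eps_gf = 2 * fps_X * omega_gf"
proof
  show "eps_gf + omega_gf = f_gf"
  proof (rule fps_ext)
    fix n
    show "fps_nth (eps_gf + omega_gf) n = fps_nth f_gf n"
      unfolding eps_gf_def omega_gf_def f_gf_def fps_add_nth fps_nth_Abs_fps
      by (cases "even n") (auto elim!: evenE oddE, presburger+)
  qed
  show "eps_gf = 2 * fps_X * omega_gf"
  proof (rule fps_ext)
    fix n
    have R: "fps_nth (2 * fps_X * omega_gf) n = (if n = 0 then 0 else 2 * fps_nth omega_gf (n - 1))"
      by (simp add: mult.assoc numeral_fps_const)
    show "fps_nth eps_gf n = fps_nth (2 * fps_X * omega_gf) n"
    proof (cases "even n \<and> n \<noteq> 0")
      case True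
      then obtain k where k: "n = 2 * Suc k" by (metis dvdE mult_0_right not0_implies_Suc)
      \<comment> \<open>Pascal's rule splits the central coefficient into the two equal middle
        entries of row \<open>2 * k + 1\<close>.\<close>
      have "2 * Suc k choose Suc k = 2 * ((2 * k + 1) choose k)"
        using binomial_symmetric[of k "2 * k + 1"] by simp
      then have "card (I321 n) = 2 * card (I321 (n - 1))" using k by (simp add: card_I321)
      moreover have "\<exists>m\<ge>1. n = 2 * m" "\<exists>m. n - 1 = 2 * m + 1" using k by auto
      ultimately show ?thesis unfolding R unfolding eps_gf_def omega_gf_def using k by simp
    next
      case False
      \<comment> \<open>For odd \<open>n\<close> both coefficients vanish by parity; for
        \<open>n = 0\<close> the left one vanishes because the empty permutation is
        excluded.\<close>
      then have "\<not> (\<exists>m\<ge>1. n = 2 * m)" "n \<noteq> 0 \<Longrightarrow> \<not> (\<exists>m. n - 1 = 2 * m + 1)" by presburger+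
      then show ?thesis unfolding R unfolding eps_gf_def omega_gf_def by auto
    qed
  qed
qed

end
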